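(* Assume the Markovian semigroup $\{P(t)\}_{t\ge0}$ on $\mathbb{X}$ has Poincaré sections $\{L_s\}_{s\in\mathbb{R}}$ and a periodic measure $\{\rho_s\}_{s\in\mathbb{R}}$ with $\mathrm{supp}(\rho_s)\subset L_s$, both of period $\tau$. If $P(t)$ satisfies the $k_{s_0}\tau$-irreducibility condition on $L_{s_0}$ for some $k_{s_0}\in\mathbb{N}\setminus\{0\}$, then $L_{s_0}=\mathrm{supp}(\rho_{s_0})$. Moreover, if the semigroup satisfies the $k_s\tau$-irreducibility condition on the Poincaré sections $L_s$ for all $s\in[0,\tau)$, then $L_s=\mathrm{supp}(\rho_s)$ for any $s\in\mathbb{R}$.
   Context: $\mathbb{X}$ is a Polish space with Borel $\sigma$-algebra $\mathcal B(\mathbb{X})$. $\{P(t)\}_{t\ge0}$ is given by transition probabilities $P(t,x,\cdot)$ satisfying the Chapman–Kolmogorov equation. $\mathbb{N}=\{0,1,2,\dots\}$. Sets $L_s\subset\mathbb{X}$, $s\ge0$, are Poincaré sections of the transition probability if $L_{s+\tau}=L_s$ and $P(t,x,L_{s+t})=1$ for all $x\in L_s$, $s,t\ge0$; they are extended to $s\in\mathbb{R}$ by periodicity. A map $\rho:\mathbb{R}\to\mathcal P(\mathbb{X})$ (Borel probability measures) is a periodic measure of period $\tau$ if $\rho_{s+\tau}=\rho_s$ and $\rho_{t+s}(B)=\int_{\mathbb{X}}P(t,x,B)\rho_s(dx)$ for all $s\in\mathbb{R}$, $t\ge0$. For fixed $s\in[0,\tau)$ and $k_s\in\mathbb{N}\setminus\{0\}$,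 the $k_s\tau$-irreducibility condition on $L_s$ is: for every nonempty relatively open set $\Gamma\subset L_s$, $P(k_s\tau,x,\Gamma)>0$ for $\rho_s$-a.e. $x\in L_s$. *)

theory Defs
  imports "HOL-Probability.Probability"
begin

(* Only P t with t >= 0 is constrained.  Measurability into prob_algebra borel says that
   every P t x is a Borel probability measure and that x |-> P t x B is Borel measurable
   for every Borel set B.  P 0 x is not required to be the Dirac measure at x. *)
definition markovian_semigroup ::
    "(real \<Rightarrow> 'a::polish_space \<Rightarrow> 'a measure) \<Rightarrow> bool" where
  "markovian_semigroup P \<longleftrightarrow>
     (\<forall>t\<ge>0. P t \<in> borel \<rightarrow>\<^sub>M prob_algebra borel) \<and>
     (\<forall>s\<ge>0. \<forall>t\<ge>0. \<forall>x. \<forall>B\<in>sets borel.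
        emeasure (P (s + t) x) B = (\<integral>\<^sup>+ y. emeasure (P t y) B \<partial>P s x))"

(* A family on the half-line extended to the real line by periodicity is the same thing as
   a family on the real line that is periodic there.  Borel measurability of the sections
   is implicit in the expression P(t,x,L_{s+t}). *)
definition poincare_sections ::
    "(real \<Rightarrow> 'a::polish_space \<Rightarrow> 'a measure) \<Rightarrow> real \<Rightarrow> (real \<Rightarrow> 'a set) \<Rightarrow> bool" where
  "poincare_sections P \<tau> L \<longleftrightarrow>
     (\<forall>s. L s \<in> sets borel) \<and>
     (\<forall>s. L (s + \<tau>) = L s) \<and>
     (\<forall>s\<ge>0. \<forall>t\<ge>0. \<forall>x\<in>L s. emeasure (P t x) (L (s + t)) = 1)"

definition periodic_measure ::
    "(real \<Rightarrow> 'a::polish_space \<Rightarrow> 'a measure) \<Rightarrow> real \<Rightarrow> (real \<Rightarrow> 'a measure) \<Rightarrow> bool" where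
  "periodic_measure P \<tau> \<rho> \<longleftrightarrow>
     (\<forall>s. \<rho> s \<in> space (prob_algebra borel)) \<and>
     (\<forall>s. \<rho> (s + \<tau>) = \<rho> s) \<and>
     (\<forall>s. \<forall>t\<ge>0. \<forall>B\<in>sets borel.
        emeasure (\<rho> (t + s)) B = (\<integral>\<^sup>+ x. emeasure (P t x) B \<partial>\<rho> s))"

(* Topological support: the points all of whose open neighbourhoods have positive measure. *)
definition measure_support :: "'a::topological_space measure \<Rightarrow> 'a set" where
  "measure_support \<mu> = {x. \<forall>U. open U \<longrightarrow> x \<in> U \<longrightarrow> emeasure \<mu> U > 0}"

(* The k * tau irreducibility condition on the section L s; the exceptional null set may
   depend on the relatively open set G. *)
definition irreducible_on_section ::
    "(real \<Rightarrow> 'a::polish_space \<Rightarrow> 'a measure) \<Rightarrow> real \<Rightarrow> (real \<Rightarrow> 'a set) \<Rightarrow> (real \<Rightarrow> 'a measure)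
      \<Rightarrow> nat \<Rightarrow> real \<Rightarrow> bool" where
  "irreducible_on_section P \<tau> L \<rho> k s \<longleftrightarrow>
     (\<forall>G. openin (top_of_set (L s)) G \<longrightarrow> G \<noteq> {} \<longrightarrow>
        (AE x in \<rho> s. x \<in> L s \<longrightarrow> emeasure (P (real k * \<tau>) x) G > 0))"

end

theory Submission
  imports Defs "HOL-Library.Periodic_Fun"
begin

text \<open>Only the inclusion of \<open>L s\<close> in the support needs an argument. Flowing for k
  periods brings \<open>\<rho> s\<close> back to itself, so it is invariant under the kernel at time
  k \<tau> (\<open>periodic_measure_shift\<close>). If a point of \<open>L s\<close> had an open
  neighbourhood U of measure zero, invariance would make the transition probability into the trace
  of U on \<open>L s\<close> vanish almost everywhere, while irreducibility makes it positive almost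
  everywhere on \<open>L s\<close>. As \<open>\<rho> s\<close> is concentrated on its support
  (\<open>AE_in_measure_support\<close>), hence on \<open>L s\<close>, this is a contradiction.
  Periodicity carries the equality from [0, \<tau>) to all real times.\<close>

text \<open>Second countability is the point: every point outside the support lies in a null set
  from a countable basis, and a countable union of null sets is null.\<close>

lemma AE_in_measure_support:
  fixes \<mu> :: "'a::second_countable_topology measure"
  assumes "sets \<mu> = sets borel"
  shows "AE x in \<mu>. x \<in> measure_support \<mu>"
proof -
  obtain \<B> :: "'a set set" where "countable \<B>" and basis: "topological_basis \<B>"
    using ex_countable_basis by auto
  define \<N> where "\<N> = {B \<in> \<B>. emeasure \<mu> B = 0}"
  have "\<N> \<subseteq> null_sets \<mu>"
    using topological_basis_open[OF basis] assms by (auto simp: \<N>_def null_sets_def)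
  moreover have "countable \<N>"
    using \<open>countable \<B>\<close> by (simp add: \<N>_def)
  ultimately have "(\<Union>B\<in>\<N>. B) \<in> null_sets \<mu>"
    by (intro null_sets_UN') blast+
  \<comment> \<open>Shrinking a null neighbourhood to a basic open set keeps it null.\<close>
  moreover have "x \<in> \<Union>\<N>" if "x \<notin> measure_support \<mu>" for x
  proof -
    from that obtain U where U: "open U" "x \<in> U" "emeasure \<mu> U = 0"
      by (auto simp: measure_support_def)
    then obtain B where "B \<in> \<B>" "x \<in> B" "B \<subseteq> U"
      using basis by (meson topological_basisE)
    moreover have "emeasure \<mu> B = 0"
      using U \<open>B \<subseteq> U\<close> assms emeasure_mono[of B U \<mu>] by simp
    ultimately show ?thesis
      by (auto simp: \<N>_def)
  qed
  ultimately show ?thesis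
    by (intro AE_I'[of "\<Union>B\<in>\<N>. B"]) auto
qed

text \<open>Each \<open>\<rho> s\<close> is an invariant measure of the chain observed at multiples
  of the period; this is how periodicity in time enters the support argument.\<close>

lemma periodic_measure_shift:
  assumes "periodic_measure P \<tau> \<rho>" "B \<in> sets borel" "\<tau> \<ge> 0"
  shows "emeasure (\<rho> s) B = (\<integral>\<^sup>+ x. emeasure (P (real k * \<tau>) x) B \<partial>\<rho> s)"
proof -
  interpret periodic_fun_simple \<rho> \<tau>
    using assms(1) by unfold_locales (simp add: periodic_measure_def)
  have "\<rho> (real k * \<tau> + s) = \<rho> s"
    using plus_of_nat[of s k] by (simp add: add.commute)
  moreover have "emeasure (\<rho> (real k * \<tau> + s)) B = (\<integral>\<^sup>+ x. emeasure (P (real k * \<tau>) x) B \<partial>\<rho> s)"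
    using assms by (simp add: periodic_measure_def)
  ultimately show ?thesis
    by simp
qed

text \<open>Invariance turns a null relatively open piece of the section into one that is almost
  surely not reached after k periods, which irreducibility forbids.\<close>

lemma section_subset_measure_support:
  fixes P :: "real \<Rightarrow> 'a::polish_space \<Rightarrow> 'a measure"
  assumes "\<tau> > 0"
    and P: "markovian_semigroup P"
    and \<rho>: "periodic_measure P \<tau> \<rho>"
    and L: "L s \<in> sets borel"
    and supp: "measure_support (\<rho> s) \<subseteq> L s"
    and irr: "irreducible_on_section P \<tau> L \<rho> k s"
  shows "L s \<subseteq> measure_support (\<rho> s)"
proof
  fix x assume x: "x \<in> L s"
  have space: "\<rho> s \<in> space (prob_algebra borel)"
    using \<rho> by (simp add: periodic_measure_def)
  then have sets: "sets (\<rho> s) = sets borel"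
    and "prob_space (\<rho> s)"
    by (auto simp: space_prob_algebra)
  then interpret prob_space "\<rho> s" by simp
  have "emeasure (\<rho> s) U \<noteq> 0" if U: "open U" "x \<in> U" for U
  proof
    assume null: "emeasure (\<rho> s) U = 0"
    \<comment> \<open>Irreducibility speaks of relatively open subsets of the section, so U is cut
      down to \<open>L s\<close>; the trace is nonempty because it contains x.\<close>
    define G where "G = L s \<inter> U"
    have G: "G \<in> sets borel"
      using L U by (simp add: G_def)
    have "emeasure (\<rho> s) G = 0"
      using null U sets emeasure_mono[of G U "\<rho> s"] by (simp add: G_def)
    then have "(\<integral>\<^sup>+ y. emeasure (P (real k * \<tau>) y) G \<partial>\<rho> s) = 0"
      using periodic_measure_shift[OF \<rho> G] \<open>\<tau> > 0\<close> by simp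
    moreover have "P (real k * \<tau>) \<in> borel \<rightarrow>\<^sub>M prob_algebra borel"
      using P \<open>\<tau> > 0\<close> by (simp add: markovian_semigroup_def)
    then have "P (real k * \<tau>) \<in> borel \<rightarrow>\<^sub>M subprob_algebra borel"
      by (rule measurable_prob_algebraD)
    then have "(\<lambda>y. emeasure (P (real k * \<tau>) y) G) \<in> borel_measurable borel"
      using G by (rule measurable_emeasure_kernel)
    then have "(\<lambda>y. emeasure (P (real k * \<tau>) y) G) \<in> borel_measurable (\<rho> s)"
      by (simp add: measurable_cong_sets[OF sets refl])
    \<comment> \<open>A nonnegative measurable function with zero integral vanishes almost
      everywhere.\<close>
    ultimately have "AE y in \<rho> s. emeasure (P (real k * \<tau>) y) G = 0"
      by (simp add: nn_integral_0_iff_AE)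
    moreover have "AE y in \<rho> s. y \<in> L s \<longrightarrow> emeasure (P (real k * \<tau>) y) G > 0"
    proof -
      have "openin (top_of_set (L s)) G" "G \<noteq> {}"
        using x U by (auto simp: G_def openin_open_Int)
      then show ?thesis
        using irr by (simp add: irreducible_on_section_def)
    qed
    \<comment> \<open>Irreducibility gives positivity only at points of \<open>L s\<close>; this
      makes it hold almost everywhere, against the vanishing above. A probability measure rules that
      out.\<close>
    moreover have "AE y in \<rho> s. y \<in> L s"
      using AE_in_measure_support[OF sets] supp by auto
    ultimately have "AE y in \<rho> s. False"
      by eventually_elim auto
    then show False
      by simp
  qed
  then show "x \<in> measure_support (\<rho> s)"
    by (auto simp: measure_support_def zero_less_iff_neq_zero)
qed

theorem lemma4p9:
  fixes P :: "real \<Rightarrow> 'a::polish_space \<Rightarrow> 'a measure"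
    and L :: "real \<Rightarrow> 'a set"
    and \<rho> :: "real \<Rightarrow> 'a measure"
    and \<tau> :: real
  assumes "\<tau> > 0"
    and "markovian_semigroup P"
    and "poincare_sections P \<tau> L"
    and "periodic_measure P \<tau> \<rho>"
    and "\<And>s. measure_support (\<rho> s) \<subseteq> L s"
  shows "(\<forall>s0\<in>{0..<\<tau>}. (\<exists>k::nat. k \<noteq> 0 \<and> irreducible_on_section P \<tau> L \<rho> k s0)
            \<longrightarrow> L s0 = measure_support (\<rho> s0)) \<and>
         ((\<forall>s\<in>{0..<\<tau>}. \<exists>k::nat. k \<noteq> 0 \<and> irreducible_on_section P \<tau> L \<rho> k s)
            \<longrightarrow> (\<forall>s. L s = measure_support (\<rho> s)))"
proof (intro conjI ballI impI allI)
  have section_eq: "L s = measure_support (\<rho> s)"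
    if "\<exists>k::nat. k \<noteq> 0 \<and> irreducible_on_section P \<tau> L \<rho> k s" for s
  proof -
    have "L s \<in> sets borel"
      using assms(3) by (simp add: poincare_sections_def)
    with that show ?thesis
      using section_subset_measure_support[OF assms(1,2,4)] assms(5) by blast
  qed
  {
    fix s0
    assume "\<exists>k::nat. k \<noteq> 0 \<and> irreducible_on_section P \<tau> L \<rho> k s0"
    then show "L s0 = measure_support (\<rho> s0)"
      by (rule section_eq)
  }
  fix s
  assume irr: "\<forall>s\<in>{0..<\<tau>}. \<exists>k::nat. k \<noteq> 0 \<and> irreducible_on_section P \<tau> L \<rho> k s"
  interpret L: periodic_fun_simple L \<tau>
    using assms(3) by unfold_locales (simp add: poincare_sections_def)
  interpret \<rho>: periodic_fun_simple \<rho> \<tau>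
    using assms(4) by unfold_locales (simp add: periodic_measure_def)
  \<comment> \<open>The representative of s modulo \<tau> in [0, \<tau>), where irreducibility is
    assumed; \<open>L\<close> and \<open>\<rho>\<close> take the same values at r and at s.\<close>
  define r where "r = s - of_int \<lfloor>s / \<tau>\<rfloor> * \<tau>"
  have "r \<in> {0..<\<tau>}"
    using floor_divide_lower[OF assms(1), of s] floor_divide_upper[OF assms(1), of s]
    by (simp add: r_def algebra_simps)
  then have "L r = measure_support (\<rho> r)"
    using irr section_eq by blast
  then show "L s = measure_support (\<rho> s)"
    by (simp add: r_def L.minus_of_int \<rho>.minus_of_int)
qed

end
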